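(* Let $X$ be a vector lattice that is a local algebra and that has no singleton d-basis (i.e. no d-basis consisting of exactly one element). Then every d-basis in $X$, whenever one exists, is infinite.
   Context: All vector lattices are real and Archimedean. A system $\{x_\gamma\}_{\gamma\in\Gamma}$ in a vector lattice $X$ is d-independent if for every band $B$ in $X$, every finite set of (distinct) indices $\{\gamma_1,\dots,\gamma_n\}\subseteq\Gamma$ and all non-zero scalars $c_1,\dots,c_n$: if $\sum_{j=1}^n c_jx_{\gamma_j}\perp B$, then $x_{\gamma_j}\perp B$ for each $j=1,\dots,n$. A d-independent system $\{e_\gamma\}_{\gamma\in\Gamma}$ in $X$ is a d-basis if for each $x\in X$ there is a full system $\{X_i:i\in I\}$ of pairwise disjoint bands in $X$ (full: only $0$ is disjoint to all $X_i$) such that for each $i\in I$ there are finitely many (possibly no) indices $\gamma_1,\dots,\gamma_n$ and non-zero scalars $c_1,\dots,c_n$ (all depending on $x$ and $i$) with $x-\sum_{j=1}^n c_je_{\gamma_j}\perp X_i$. For $x\in X$ let $X(x)=\{x'\in X:|x'|\le\lambda|x|\text{ for some }\lambda\in\mathbb{R}\}$ be the principal ideal generated by $x$. There is a compact Hausdorff space $K_x$, unique up to homeomorphism, such that $X(x)$ is order isomorphic (linearly and lattice isomorphic) to an order dense vector sublattice of $C(K_x)$ separating the points of $K_x$, with $|x|$ mapped to the constant function $\mathbf{1}$ (the Kakutani–Krein representation). $X$ is a local algebra if for each $x\in X$ the image of $X(x)$ under this representation is a subalgebra (as well as a vector sublattice) of $C(K_x)$. *)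

theory Defs
  imports "HOL-Analysis.Analysis" "HOL-Library.Lattice_Algebras" "HOL-Library.Lub_Glb"
begin

class archimedean_vector_lattice = ordered_real_vector + lattice_ab_group_add_abs +
  assumes archimedean_vl: "0 \<le> x \<Longrightarrow> (\<And>n::nat. real n *\<^sub>R x \<le> y) \<Longrightarrow> x = 0"


definition vl_disjoint :: "'a::archimedean_vector_lattice \<Rightarrow> 'a \<Rightarrow> bool"
  where "vl_disjoint x y \<longleftrightarrow> inf \<bar>x\<bar> \<bar>y\<bar> = 0"

definition vl_disjoint_set :: "'a::archimedean_vector_lattice \<Rightarrow> 'a set \<Rightarrow> bool"
  where "vl_disjoint_set x B \<longleftrightarrow> (\<forall>b\<in>B. vl_disjoint x b)"

definition order_ideal :: "'a::archimedean_vector_lattice set \<Rightarrow> bool"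
  where "order_ideal B \<longleftrightarrow> subspace B \<and> (\<forall>x y. y \<in> B \<longrightarrow> \<bar>x\<bar> \<le> \<bar>y\<bar> \<longrightarrow> x \<in> B)"

text \<open>Suprema are taken in the whole space.\<close>

definition band :: "'a::archimedean_vector_lattice set \<Rightarrow> bool"
  where "band B \<longleftrightarrow> order_ideal B \<and> (\<forall>D s. D \<subseteq> B \<longrightarrow> isLub UNIV D s \<longrightarrow> s \<in> B)"

definition full_disjoint_bands :: "'a::archimedean_vector_lattice set set \<Rightarrow> bool"
  where "full_disjoint_bands \<X> \<longleftrightarrow>
    (\<forall>B\<in>\<X>. band B) \<and>
    (\<forall>A\<in>\<X>. \<forall>B\<in>\<X>. A \<noteq> B \<longrightarrow> (\<forall>a\<in>A. vl_disjoint_set a B)) \<and>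
    (\<forall>y. (\<forall>B\<in>\<X>. vl_disjoint_set y B) \<longrightarrow> y = 0)"

text \<open>Systems are indexed families: \<open>\<Gamma>\<close> is the index set, and only the values of \<open>e\<close> on it matter.\<close>

definition d_independent :: "'i set \<Rightarrow> ('i \<Rightarrow> 'a::archimedean_vector_lattice) \<Rightarrow> bool"
  where "d_independent \<Gamma> e \<longleftrightarrow>
    (\<forall>B F c. band B \<longrightarrow> finite F \<longrightarrow> F \<subseteq> \<Gamma> \<longrightarrow> (\<forall>\<gamma>\<in>F. c \<gamma> \<noteq> (0::real)) \<longrightarrow>
       vl_disjoint_set (\<Sum>\<gamma>\<in>F. c \<gamma> *\<^sub>R e \<gamma>) B \<longrightarrow> (\<forall>\<gamma>\<in>F. vl_disjoint_set (e \<gamma>) B))"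

definition d_basis :: "'i set \<Rightarrow> ('i \<Rightarrow> 'a::archimedean_vector_lattice) \<Rightarrow> bool"
  where "d_basis \<Gamma> e \<longleftrightarrow> d_independent \<Gamma> e \<and>
    (\<forall>x. \<exists>\<X>. full_disjoint_bands \<X> \<and>
       (\<forall>B\<in>\<X>. \<exists>F c. finite F \<and> F \<subseteq> \<Gamma> \<and> (\<forall>\<gamma>\<in>F. c \<gamma> \<noteq> (0::real)) \<and>
          vl_disjoint_set (x - (\<Sum>\<gamma>\<in>F. c \<gamma> *\<^sub>R e \<gamma>)) B))"


definition principal_ideal :: "'a::archimedean_vector_lattice \<Rightarrow> 'a set"
  where "principal_ideal x = {x'. \<exists>l::real. \<bar>x'\<bar> \<le> l *\<^sub>R \<bar>x\<bar>}"

text \<open>Elements of \<open>C(K)\<close> are extensional functions, so that equality in \<open>C(K)\<close> is equality of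
  functions.\<close>

definition C_space :: "'k topology \<Rightarrow> ('k \<Rightarrow> real) set"
  where "C_space K = {f \<in> extensional (topspace K). continuous_map K euclideanreal f}"

definition order_dense_in_C :: "'k topology \<Rightarrow> ('k \<Rightarrow> real) set \<Rightarrow> bool"
  where "order_dense_in_C K L \<longleftrightarrow>
    (\<forall>f\<in>C_space K. (\<forall>t\<in>topspace K. 0 \<le> f t) \<and> (\<exists>t\<in>topspace K. f t \<noteq> 0) \<longrightarrow>
       (\<exists>g\<in>L. (\<forall>t\<in>topspace K. 0 \<le> g t \<and> g t \<le> f t) \<and> (\<exists>t\<in>topspace K. g t \<noteq> 0)))"

definition separates_points :: "'k topology \<Rightarrow> ('k \<Rightarrow> real) set \<Rightarrow> bool"
  where "separates_points K L \<longleftrightarrow>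
    (\<forall>s\<in>topspace K. \<forall>t\<in>topspace K. s \<noteq> t \<longrightarrow> (\<exists>f\<in>L. f s \<noteq> f t))"

definition vector_sublattice_C :: "'k topology \<Rightarrow> ('k \<Rightarrow> real) set \<Rightarrow> bool"
  where "vector_sublattice_C K L \<longleftrightarrow> L \<subseteq> C_space K \<and> L \<noteq> {} \<and>
    (\<forall>f\<in>L. \<forall>g\<in>L. (\<lambda>t\<in>topspace K. f t + g t) \<in> L) \<and>
    (\<forall>f\<in>L. \<forall>r. (\<lambda>t\<in>topspace K. r * f t) \<in> L) \<and>
    (\<forall>f\<in>L. \<forall>g\<in>L. (\<lambda>t\<in>topspace K. max (f t) (g t)) \<in> L) \<and>
    (\<forall>f\<in>L. \<forall>g\<in>L. (\<lambda>t\<in>topspace K. min (f t) (g t)) \<in> L)"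

definition subalgebra_C :: "'k topology \<Rightarrow> ('k \<Rightarrow> real) set \<Rightarrow> bool"
  where "subalgebra_C K L \<longleftrightarrow> L \<subseteq> C_space K \<and> L \<noteq> {} \<and>
    (\<forall>f\<in>L. \<forall>g\<in>L. (\<lambda>t\<in>topspace K. f t + g t) \<in> L) \<and>
    (\<forall>f\<in>L. \<forall>r. (\<lambda>t\<in>topspace K. r * f t) \<in> L) \<and>
    (\<forall>f\<in>L. \<forall>g\<in>L. (\<lambda>t\<in>topspace K. f t * g t) \<in> L)"

definition order_iso_into_C ::
    "'a::archimedean_vector_lattice set \<Rightarrow> 'k topology \<Rightarrow> ('a \<Rightarrow> 'k \<Rightarrow> real) \<Rightarrow> bool"
  where "order_iso_into_C J K \<Phi> \<longleftrightarrow> \<Phi> ` J \<subseteq> C_space K \<and> inj_on \<Phi> J \<and>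
    (\<forall>y\<in>J. \<forall>z\<in>J. \<forall>t\<in>topspace K. \<Phi> (y + z) t = \<Phi> y t + \<Phi> z t) \<and>
    (\<forall>y\<in>J. \<forall>r. \<forall>t\<in>topspace K. \<Phi> (r *\<^sub>R y) t = r * \<Phi> y t) \<and>
    (\<forall>y\<in>J. \<forall>z\<in>J. \<forall>t\<in>topspace K. \<Phi> (sup y z) t = max (\<Phi> y t) (\<Phi> z t)) \<and>
    (\<forall>y\<in>J. \<forall>z\<in>J. \<forall>t\<in>topspace K. \<Phi> (inf y z) t = min (\<Phi> y t) (\<Phi> z t))"

text \<open>\<open>(K, \<Phi>)\<close> is a Kakutani--Krein representation of \<open>X(x)\<close>.\<close>

definition kakutani_krein_rep ::
    "'a::archimedean_vector_lattice \<Rightarrow> 'k topology \<Rightarrow> ('a \<Rightarrow> 'k \<Rightarrow> real) \<Rightarrow> bool"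
  where "kakutani_krein_rep x K \<Phi> \<longleftrightarrow>
    compact_space K \<and> Hausdorff_space K \<and>
    order_iso_into_C (principal_ideal x) K \<Phi> \<and>
    (\<forall>t\<in>topspace K. \<Phi> \<bar>x\<bar> t = 1) \<and>
    vector_sublattice_C K (\<Phi> ` principal_ideal x) \<and>
    order_dense_in_C K (\<Phi> ` principal_ideal x) \<and>
    separates_points K (\<Phi> ` principal_ideal x)"

text \<open>The points of the representing space are taken in the type \<open>'a \<Rightarrow> real\<close>. This is no
  restriction: it is unique up to homeomorphism and can be realized as the set of real lattice
  homomorphisms on \<open>X(x)\<close> sending \<open>\<bar>x\<bar>\<close> to 1 (extended by 0 outside \<open>X(x)\<close>), with the topology of
  pointwise convergence. By the uniqueness, asking for some representation is the same as
  asking for every representation.\<close>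

definition local_algebra :: "'a::archimedean_vector_lattice itself \<Rightarrow> bool"
  where "local_algebra _ \<longleftrightarrow>
    (\<forall>x::'a. \<exists>(K :: ('a \<Rightarrow> real) topology) \<Phi>.
       kakutani_krein_rep x K \<Phi> \<and> subalgebra_C K (\<Phi> ` principal_ideal x))"

end

theory Submission
  imports Defs
begin

text \<open>
  Suppose that a local algebra has a finite d-basis \<open>e\<^sub>1, \<dots>, e\<^sub>n\<close>. Then the single element
  \<open>u = \<bar>e\<^sub>1\<bar> + \<dots> + \<bar>e\<^sub>n\<bar>\<close> is already a d-basis.

  The principal ideal of \<open>u\<close> is an algebra of continuous functions in which \<open>u\<close> is the constant
  function 1. So for \<open>f = e\<^sub>j\<close> it contains all the powers \<open>f\<^sup>0, \<dots>, f\<^sup>n\<close>. On the support of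
  a suitable small positive element \<open>w\<close>, each of these \<open>n + 1\<close> powers coincides with a linear
  combination of the \<open>n\<close> elements \<open>e\<^sub>i\<close>. Hence some nontrivial combination of the powers vanishes
  there: on the support of \<open>w\<close> the function \<open>f\<close> satisfies a polynomial equation with constant
  coefficients and so takes only finitely many values
  (\<open>exists_linear_dependence\<close>, \<open>locally_scalar_in_local_algebra\<close>). A continuous function with finitely
  many values is locally constant, and cutting \<open>w\<close> down to where \<open>f\<close> is close to one of these
  values gives a smaller positive element on whose support \<open>f\<close> is a scalar multiple of \<open>u\<close>
  (\<open>locally_scalar_if_finite_range\<close>). Doing this for every \<open>e\<^sub>j\<close> in turn, and using that an arbitrary
  \<open>x\<close> is locally a linear combination of the \<open>e\<^sub>j\<close>, one finds that \<open>x\<close> is locally a scalar multiple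
  of \<open>u\<close>.

  "Locally" means here: below every nonzero positive element there is a nonzero positive element \<open>w\<close>
  such that the difference of the two sides is disjoint from \<open>w\<close>. This is equivalent to the
  formulation with a full system of disjoint bands. One direction picks an element of a band of the
  system (\<open>full_disjoint_bands_dense\<close>), the other takes the bands generated by a maximal disjoint
  family of such \<open>w\<close> (\<open>full_disjoint_bands_of_dense\<close>).
\<close>

section \<open>Disjointness and order ideals\<close>

lemma abs_scaleR_le:
  fixes x :: "'a::archimedean_vector_lattice"
  shows "\<bar>c *\<^sub>R x\<bar> \<le> \<bar>c\<bar> *\<^sub>R \<bar>x\<bar>"
proof -
  have *: "d *\<^sub>R x \<le> \<bar>d\<bar> *\<^sub>R \<bar>x\<bar>" for d
  proof (cases "0 \<le> d")
    case True
    then show ?thesis by (simp add: scaleR_left_mono abs_ge_self)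
  next
    case False
    then have "(- d) *\<^sub>R (- x) \<le> (- d) *\<^sub>R \<bar>x\<bar>"
      by (intro scaleR_left_mono abs_ge_minus_self) simp
    with False show ?thesis by simp
  qed
  show ?thesis
    using *[of c] *[of "- c"] by (intro abs_leI) simp_all
qed

lemma abs_pprt_le:
  fixes x :: "'a::archimedean_vector_lattice"
  shows "\<bar>pprt x\<bar> \<le> \<bar>x\<bar>"
  by (simp add: pprt_def abs_of_nonneg abs_ge_self)

lemma vl_disjoint_commute: "vl_disjoint x y \<longleftrightarrow> vl_disjoint y x"
  by (simp add: vl_disjoint_def inf_commute)

lemma vl_disjoint_mono:
  assumes "vl_disjoint x y" "\<bar>x'\<bar> \<le> \<bar>x\<bar>" "\<bar>y'\<bar> \<le> \<bar>y\<bar>"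
  shows "vl_disjoint x' y'"
proof -
  have "inf \<bar>x'\<bar> \<bar>y'\<bar> \<le> inf \<bar>x\<bar> \<bar>y\<bar>"
    by (rule inf_mono[OF assms(2,3)])
  then have "inf \<bar>x'\<bar> \<bar>y'\<bar> \<le> 0"
    unfolding assms(1)[unfolded vl_disjoint_def] .
  then show ?thesis
    by (simp add: vl_disjoint_def order_antisym)
qed

lemma vl_disjoint_self: "vl_disjoint x x \<Longrightarrow> x = 0"
  by (simp add: vl_disjoint_def)

lemma vl_disjoint_0: "vl_disjoint 0 y"
  by (simp add: vl_disjoint_def inf_absorb1)

lemma vl_disjoint_add:
  assumes "vl_disjoint x z" "vl_disjoint y z"
  shows "vl_disjoint (x + y) z"
proof -
  let ?m = "inf \<bar>x + y\<bar> \<bar>z\<bar>"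
  \<comment> \<open>The infimum is subadditive: expanding the sum of the two infima gives the infimum of four
    sums, each of which dominates \<open>?m\<close>.\<close>
  have m: "?m \<le> \<bar>x\<bar> + \<bar>y\<bar>" "?m \<le> \<bar>z\<bar>"
    by (auto intro: le_infI1 abs_triangle_ineq)
  have "?m \<le> inf (\<bar>x\<bar>) (\<bar>z\<bar>) + inf (\<bar>y\<bar>) (\<bar>z\<bar>)"
    unfolding add_inf_distrib_left add_inf_distrib_right
    using m by (auto intro: order_trans[OF m(2)] add_increasing add_increasing2)
  with assms have "?m \<le> 0" by (simp add: vl_disjoint_def)
  then show ?thesis by (simp add: vl_disjoint_def order_antisym)
qed

lemma vl_disjoint_scaleR:
  assumes "vl_disjoint x z"
  shows "vl_disjoint (c *\<^sub>R x) z"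
proof -
  \<comment> \<open>The summand 1 makes \<open>?s\<close> positive and at least 1, so that \<open>?m\<close> can be divided by it
    and still lies below \<open>\<bar>z\<bar>\<close>.\<close>
  let ?s = "1 + \<bar>c\<bar>" and ?m = "inf \<bar>c *\<^sub>R x\<bar> \<bar>z\<bar>"
  have s: "0 < ?s" by simp
  have "?m \<le> \<bar>c\<bar> *\<^sub>R \<bar>x\<bar>" by (rule le_infI1[OF abs_scaleR_le])
  also have "\<dots> \<le> ?s *\<^sub>R \<bar>x\<bar>" by (rule scaleR_right_mono) simp_all
  finally have 1: "?m /\<^sub>R ?s \<le> \<bar>x\<bar>" by (simp add: pos_divideR_le_eq[OF s])
  have "1 *\<^sub>R \<bar>z\<bar> \<le> ?s *\<^sub>R \<bar>z\<bar>" by (rule scaleR_right_mono) simp_all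
  then have "?m \<le> ?s *\<^sub>R \<bar>z\<bar>" by (simp add: le_infI2)
  then have "?m /\<^sub>R ?s \<le> \<bar>z\<bar>" by (simp add: pos_divideR_le_eq[OF s])
  with 1 have "?m /\<^sub>R ?s \<le> inf \<bar>x\<bar> \<bar>z\<bar>" by (rule le_infI)
  then have "?m /\<^sub>R ?s \<le> 0" unfolding assms[unfolded vl_disjoint_def] .
  then have "?m \<le> 0" unfolding pos_divideR_le_eq[OF s] scaleR_zero_right .
  then show ?thesis by (simp add: vl_disjoint_def order_antisym)
qed

lemma subspace_vl_disjoint: "subspace {x. vl_disjoint x z}"
  by (auto simp: subspace_def vl_disjoint_0 vl_disjoint_add vl_disjoint_scaleR)

lemma vl_disjoint_sum: "(\<And>i. i \<in> I \<Longrightarrow> vl_disjoint (f i) z) \<Longrightarrow> vl_disjoint (\<Sum>i\<in>I. f i) z"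
  using subspace_sum[OF subspace_vl_disjoint, of I f z] by simp

lemma order_ideal_principal_ideal: "order_ideal (principal_ideal u)"
proof -
  have "0 \<in> principal_ideal u"
    by (auto simp: principal_ideal_def intro!: exI[of _ 0])
  moreover have "x + y \<in> principal_ideal u" if "x \<in> principal_ideal u" "y \<in> principal_ideal u" for x y
  proof -
    obtain k m where "\<bar>x\<bar> \<le> k *\<^sub>R \<bar>u\<bar>" "\<bar>y\<bar> \<le> m *\<^sub>R \<bar>u\<bar>"
      using \<open>x \<in> _\<close> \<open>y \<in> _\<close> unfolding principal_ideal_def by blast
    from order_trans[OF abs_triangle_ineq add_mono[OF this]]
    have "\<bar>x + y\<bar> \<le> (k + m) *\<^sub>R \<bar>u\<bar>" by (simp only: scaleR_add_left)
    then show ?thesis unfolding principal_ideal_def by blast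
  qed
  moreover have "c *\<^sub>R x \<in> principal_ideal u" if x: "x \<in> principal_ideal u" for x c
  proof -
    obtain k where k: "\<bar>x\<bar> \<le> k *\<^sub>R \<bar>u\<bar>"
      using x unfolding principal_ideal_def by blast
    have "\<bar>c *\<^sub>R x\<bar> \<le> (\<bar>c\<bar> * k) *\<^sub>R \<bar>u\<bar>"
      using order_trans[OF abs_scaleR_le scaleR_left_mono[OF k, of "\<bar>c\<bar>"]] by simp
    then show ?thesis unfolding principal_ideal_def by blast
  qed
  moreover have "x \<in> principal_ideal u" if "y \<in> principal_ideal u" "\<bar>x\<bar> \<le> \<bar>y\<bar>" for x y
  proof -
    obtain k where "\<bar>y\<bar> \<le> k *\<^sub>R \<bar>u\<bar>"
      using \<open>y \<in> _\<close> unfolding principal_ideal_def by blast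
    from order_trans[OF that(2) this] show ?thesis unfolding principal_ideal_def by blast
  qed
  ultimately show ?thesis by (simp add: order_ideal_def subspace_def)
qed

section \<open>Bands\<close>

definition disjoint_complement :: "'a::archimedean_vector_lattice set \<Rightarrow> 'a set"
  where "disjoint_complement D = {x. vl_disjoint_set x D}"

text \<open>The point is closure under suprema \<open>s\<close> of sets \<open>A\<close>. The overlap \<open>t\<close> of the positive part of \<open>s\<close>
  with the modulus of an element of \<open>D\<close> is disjoint from all elements of \<open>A\<close>, so that \<open>s - t\<close> is still an upper bound of
  \<open>A\<close> and \<open>t\<close> must vanish; the negative part of \<open>s\<close> is dominated by that of any element of \<open>A\<close>.\<close>

lemma band_disjoint_complement: "band (disjoint_complement D)"
proof -
  have closed: "disjoint_complement D = (\<Inter>d\<in>D. {x. vl_disjoint x d})"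
    by (auto simp: disjoint_complement_def vl_disjoint_set_def)
  have "subspace (disjoint_complement D)"
    unfolding closed by (rule subspace_Inter) (auto simp: subspace_vl_disjoint)
  moreover have "x \<in> disjoint_complement D"
    if "y \<in> disjoint_complement D" "\<bar>x\<bar> \<le> \<bar>y\<bar>" for x y
    using that by (auto simp: disjoint_complement_def vl_disjoint_set_def intro: vl_disjoint_mono)
  ultimately have "order_ideal (disjoint_complement D)"
    unfolding order_ideal_def by blast
  moreover have "vl_disjoint s b"
    if A: "A \<subseteq> disjoint_complement D" and lub: "isLub UNIV A s" and b: "b \<in> D" for A s b
  proof -
    have upper: "a \<le> s" if "a \<in> A" for a
      using lub that by (auto simp: isLub_def leastP_def isUb_def setle_def)
    have least: "s \<le> y" if "\<And>a. a \<in> A \<Longrightarrow> a \<le> y" for y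
      using lub that by (auto simp: isLub_def leastP_def isUb_def setle_def setge_def)
    have disj: "vl_disjoint a b" if "a \<in> A" for a
      using A b that by (auto simp: disjoint_complement_def vl_disjoint_set_def)
    define t where "t = inf (pprt s) \<bar>b\<bar>"
    have t0: "0 \<le> t" by (simp add: t_def)
    have "a \<le> s - t" if a: "a \<in> A" for a
    proof -
      have "vl_disjoint (pprt a) t"
        by (rule vl_disjoint_mono[OF disj[OF a] abs_pprt_le]) (simp add: t_def abs_of_nonneg)
      then have "inf (pprt a) t = 0" using t0 by (simp add: vl_disjoint_def abs_of_nonneg)
      then have "pprt a + t = sup (pprt a) t" using add_eq_inf_sup[of "pprt a" t] by simp
      also have "\<dots> \<le> pprt s" using upper[OF a] by (simp add: t_def)
      finally have "pprt a \<le> pprt s - t" by (simp add: le_diff_eq)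
      moreover have "nprt a \<le> nprt s" using upper[OF a] by simp
      ultimately have "pprt a + nprt a \<le> pprt s - t + nprt s" by (rule add_mono)
      then show ?thesis using prts[of a] prts[of s] by (simp add: algebra_simps)
    qed
    then have "s \<le> s - t" by (rule least)
    then have "t = 0" using t0 by (simp add: order_antisym)
    then have pos: "vl_disjoint (pprt s) b" by (simp add: t_def vl_disjoint_def)
    have neg: "vl_disjoint (nprt s) b"
    proof (cases "A = {}")
      case True
      \<comment> \<open>Every element is an upper bound of the empty set, so the whole space is trivial.\<close>
      then have "0 \<le> y" for y :: 'a using least[of "s + y"] by simp
      then have "s = 0" by (metis neg_0_le_iff_le order_antisym)
      then show ?thesis by (simp add: vl_disjoint_0)
    next
      case False
      then obtain a where a: "a \<in> A" by auto
      have "\<bar>nprt s\<bar> = - nprt s" by (simp add: abs_of_nonpos)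
      also have "\<dots> \<le> - nprt a" using upper[OF a] by simp
      also have "\<dots> \<le> \<bar>a\<bar>" by (simp add: abs_prts)
      finally show ?thesis by (rule vl_disjoint_mono[OF disj[OF a]]) simp
    qed
    show ?thesis using vl_disjoint_add[OF pos neg] by (simp add: prts[symmetric])
  qed
  then have "s \<in> disjoint_complement D" if "A \<subseteq> disjoint_complement D" "isLub UNIV A s" for A s
    using that by (simp add: disjoint_complement_def vl_disjoint_set_def)
  ultimately show ?thesis by (simp add: band_def)
qed

lemma full_disjoint_bands_dense:
  assumes full: "full_disjoint_bands \<X>" and z: "0 \<le> z" "z \<noteq> 0"
  obtains B w where "B \<in> \<X>" "w \<in> B" "0 \<le> w" "w \<noteq> 0" "w \<le> z"
proof -
  obtain B b where B: "B \<in> \<X>" and b: "b \<in> B" "\<not> vl_disjoint z b"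
  proof -
    have "\<not> (\<forall>B\<in>\<X>. vl_disjoint_set z B)"
      using full z(2) unfolding full_disjoint_bands_def by metis
    then show thesis using that unfolding vl_disjoint_set_def by blast
  qed
  let ?w = "inf z \<bar>b\<bar>"
  have "order_ideal B" using full B by (simp add: full_disjoint_bands_def band_def)
  moreover have "\<bar>?w\<bar> \<le> \<bar>b\<bar>" using z by (simp add: abs_of_nonneg)
  ultimately have "?w \<in> B" using b(1) unfolding order_ideal_def by metis
  with that[of B ?w] B b z show thesis by (simp add: vl_disjoint_def abs_of_nonneg)
qed

text \<open>By Zorn's lemma there is a maximal disjoint family of nonzero elements with the property \<open>P\<close>. A
  nonzero element disjoint from all the bands \<open>{w}\<^sup>d\<^sup>d\<close> that the members \<open>w\<close> of the family generate
  would have below its modulus one more element with \<open>P\<close>, contradicting maximality.\<close>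

lemma full_disjoint_bands_of_dense:
  fixes P :: "'a::archimedean_vector_lattice \<Rightarrow> bool"
  assumes dense: "\<And>z. 0 \<le> z \<Longrightarrow> z \<noteq> 0 \<Longrightarrow> \<exists>w. 0 \<le> w \<and> w \<noteq> 0 \<and> w \<le> z \<and> P w"
  obtains \<X> where "full_disjoint_bands \<X>"
    "\<And>B. B \<in> \<X> \<Longrightarrow> \<exists>w. P w \<and> B = disjoint_complement (disjoint_complement {w})"
proof -
  define \<W> where "\<W> = {W. (\<forall>w\<in>W. w \<noteq> 0 \<and> P w) \<and> pairwise vl_disjoint W}"
  have "\<exists>M\<in>\<W>. \<forall>X\<in>\<W>. M \<subseteq> X \<longrightarrow> X = M"
  proof (rule subset_Zorn')
    fix C assume C: "subset.chain \<W> C"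
    then have "C \<subseteq> \<W>" by (simp add: subset.chain_def)
    moreover have "pairwise vl_disjoint (\<Union>C)"
      using C \<open>C \<subseteq> \<W>\<close>
      by (intro pairwise_chain_Union) (auto simp: \<W>_def subset_chain_def chain_subset_def)
    ultimately show "\<Union>C \<in> \<W>" by (auto simp: \<W>_def)
  qed
  then obtain W where W: "W \<in> \<W>" and max: "\<And>X. X \<in> \<W> \<Longrightarrow> W \<subseteq> X \<Longrightarrow> X = W" by blast
  let ?band = "\<lambda>w::'a. disjoint_complement (disjoint_complement {w})"
  have mem: "w \<in> ?band w" for w
    by (auto simp: disjoint_complement_def vl_disjoint_set_def vl_disjoint_commute)
  have disj: "vl_disjoint a b"
    if "v \<in> W" "w \<in> W" "v \<noteq> w" "a \<in> ?band v" "b \<in> ?band w" for v w a b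
  proof -
    have "vl_disjoint v w"
      using W that(1-3) by (auto simp: \<W>_def pairwise_def)
    then have "v \<in> disjoint_complement {w}"
      by (simp add: disjoint_complement_def vl_disjoint_set_def)
    with that(5) have "b \<in> disjoint_complement {v}"
      by (auto simp: disjoint_complement_def vl_disjoint_set_def)
    with that(4) show ?thesis by (auto simp: disjoint_complement_def vl_disjoint_set_def)
  qed
  have full: "y = 0" if y: "\<forall>B\<in>?band ` W. vl_disjoint_set y B" for y
  proof (rule ccontr)
    assume "y \<noteq> 0"
    then obtain v where v: "0 \<le> v" "v \<noteq> 0" "v \<le> \<bar>y\<bar>" "P v"
      using dense[of "\<bar>y\<bar>"] by auto
    have vW: "vl_disjoint v w" if "w \<in> W" for w
    proof -
      have "vl_disjoint y w" using y mem[of w] that by (auto simp: vl_disjoint_set_def)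
      then show ?thesis by (rule vl_disjoint_mono) (use v in \<open>auto simp: abs_of_nonneg\<close>)
    qed
    have "insert v W \<in> \<W>"
      using W v vW by (auto simp: \<W>_def pairwise_insert vl_disjoint_commute)
    then have "v \<in> W" using max[of "insert v W"] by auto
    from vl_disjoint_self[OF vW[OF this]] v show False by simp
  qed
  show thesis
  proof (rule that)
    show "full_disjoint_bands (?band ` W)"
      unfolding full_disjoint_bands_def
    proof (intro conjI ballI impI allI)
      fix A B a
      assume "A \<in> ?band ` W" "B \<in> ?band ` W" "A \<noteq> B" "a \<in> A"
      then show "vl_disjoint_set a B"
        unfolding vl_disjoint_set_def by (auto intro: disj)
    qed (use full band_disjoint_complement in auto)
  qed (use W in \<open>auto simp: \<W>_def\<close>)
qed

section \<open>A linear dependence\<close>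

text \<open>A homogeneous linear system with more unknowns \<open>l k\<close> than equations has a nontrivial solution.
  The induction on the equations eliminates one unknown \<open>l p\<close> with each of them.\<close>

lemma exists_linear_dependence:
  fixes c :: "'k \<Rightarrow> 'i \<Rightarrow> real"
  assumes "finite \<Gamma>" "finite A" "card \<Gamma> < card A"
  shows "\<exists>l. (\<exists>k\<in>A. l k \<noteq> 0) \<and> (\<forall>j\<in>\<Gamma>. (\<Sum>k\<in>A. l k * c k j) = 0)"
  using assms
proof (induction \<Gamma> arbitrary: A c rule: finite_induct)
  case empty
  then obtain k where "k \<in> A" by fastforce
  then show ?case by (auto intro!: exI[of _ "\<lambda>_. 1"])
next
  case (insert i \<Gamma>)
  show ?case
  proof (cases "\<forall>k\<in>A. c k i = 0")
    case True
    have "card \<Gamma> < card A" using insert by simp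
    then obtain l where "\<exists>k\<in>A. l k \<noteq> 0" "\<forall>j\<in>\<Gamma>. (\<Sum>k\<in>A. l k * c k j) = 0"
      using insert.IH[of A c] insert.prems by blast
    with True show ?thesis by (intro exI[of _ l]) auto
  next
    case False
    then obtain p where p: "p \<in> A" "c p i \<noteq> 0" by blast
    let ?c = "\<lambda>k j. c k j - c k i / c p i * c p j"
    have "card \<Gamma> < card (A - {p})" using insert p by simp
    then obtain l where l: "\<exists>k\<in>A - {p}. l k \<noteq> 0"
      "\<forall>j\<in>\<Gamma>. (\<Sum>k\<in>A - {p}. l k * ?c k j) = 0"
      using insert.IH[of "A - {p}" ?c] insert.prems by blast
    define m where "m = l (p := - (\<Sum>k\<in>A - {p}. l k * (c k i / c p i)))"
    have "(\<Sum>k\<in>A. m k * c k j) = (\<Sum>k\<in>A - {p}. l k * ?c k j)" for j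
    proof -
      have "(\<Sum>k\<in>A. m k * c k j) = m p * c p j + (\<Sum>k\<in>A - {p}. m k * c k j)"
        using insert.prems p by (simp add: sum.remove)
      also have "(\<Sum>k\<in>A - {p}. m k * c k j) = (\<Sum>k\<in>A - {p}. l k * c k j)"
        by (rule sum.cong) (auto simp: m_def)
      also have "m p * c p j = - (\<Sum>k\<in>A - {p}. l k * (c k i / c p i * c p j))"
        by (simp add: m_def sum_distrib_right mult.assoc)
      finally show ?thesis
        by (simp add: right_diff_distrib sum_subtractf)
    qed
    then have "\<forall>j\<in>insert i \<Gamma>. (\<Sum>k\<in>A. m k * c k j) = 0"
      using l p by auto
    moreover have "\<exists>k\<in>A. m k \<noteq> 0" using l by (auto simp: m_def)
    ultimately show ?thesis by blast
  qed
qed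

section \<open>Representations by continuous functions\<close>

text \<open>The part of a Kakutani--Krein representation that the argument needs: the principal ideal of \<open>u\<close>
  as a lattice of continuous functions with unit \<open>\<bar>u\<bar>\<close>. Statements about disjointness in the ideal
  become pointwise statements about supports.\<close>

locale function_representation =
  fixes u :: "'a::archimedean_vector_lattice" and K :: "'k topology" and \<Phi>
  assumes iso: "order_iso_into_C (principal_ideal u) K \<Phi>"
    and unit: "t \<in> topspace K \<Longrightarrow> \<Phi> \<bar>u\<bar> t = 1"
begin

abbreviation "J \<equiv> principal_ideal u"

lemma subspace_J: "subspace J"
  and solid_J: "y \<in> J \<Longrightarrow> \<bar>x\<bar> \<le> \<bar>y\<bar> \<Longrightarrow> x \<in> J"
  using order_ideal_principal_ideal[of u] by (auto simp: order_ideal_def)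

lemma abs_J: "x \<in> J \<Longrightarrow> \<bar>x\<bar> \<in> J"
  by (erule solid_J) simp

lemma unit_J: "\<bar>u\<bar> \<in> J"
  by (auto simp: principal_ideal_def intro!: exI[of _ 1])

lemma diff_scaled_unit_J: "x \<in> J \<Longrightarrow> x - r *\<^sub>R \<bar>u\<bar> \<in> J"
  by (intro subspace_diff[OF subspace_J] subspace_scale[OF subspace_J] unit_J)

lemma rep_ext:
  assumes "x \<in> J" "y \<in> J" "\<And>t. t \<in> topspace K \<Longrightarrow> \<Phi> x t = \<Phi> y t"
  shows "x = y"
proof -
  have "\<Phi> x \<in> extensional (topspace K)" "\<Phi> y \<in> extensional (topspace K)"
    using iso assms by (auto simp: order_iso_into_C_def C_space_def)
  then have "\<Phi> x = \<Phi> y" using assms(3) by (rule extensionalityI)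
  then show ?thesis using iso assms by (auto simp: order_iso_into_C_def inj_on_def)
qed

context
  fixes t assumes t: "t \<in> topspace K"
begin

lemma rep_add: "x \<in> J \<Longrightarrow> y \<in> J \<Longrightarrow> \<Phi> (x + y) t = \<Phi> x t + \<Phi> y t"
  and rep_scaleR: "x \<in> J \<Longrightarrow> \<Phi> (r *\<^sub>R x) t = r * \<Phi> x t"
  and rep_sup: "x \<in> J \<Longrightarrow> y \<in> J \<Longrightarrow> \<Phi> (sup x y) t = max (\<Phi> x t) (\<Phi> y t)"
  and rep_inf: "x \<in> J \<Longrightarrow> y \<in> J \<Longrightarrow> \<Phi> (inf x y) t = min (\<Phi> x t) (\<Phi> y t)"
  using iso t by (auto simp: order_iso_into_C_def)

lemma rep_0: "\<Phi> 0 t = 0"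
  using rep_scaleR[of 0 0] subspace_0[OF subspace_J] by simp

lemma rep_diff: "x \<in> J \<Longrightarrow> y \<in> J \<Longrightarrow> \<Phi> (x - y) t = \<Phi> x t - \<Phi> y t"
  using rep_add[of "x - y" y] by (simp add: subspace_diff[OF subspace_J])

lemma rep_abs: 
  assumes "x \<in> J" shows "\<Phi> \<bar>x\<bar> t = \<bar>\<Phi> x t\<bar>"
proof -
  have "\<Phi> \<bar>x\<bar> t = max (\<Phi> x t) (\<Phi> ((-1) *\<^sub>R x) t)"
    using assms rep_sup[of x "- x"] by (simp add: abs_lattice subspace_neg[OF subspace_J])
  then show ?thesis using rep_scaleR[OF assms, of "-1"] by auto
qed

lemma rep_sum: "(\<And>i. i \<in> I \<Longrightarrow> f i \<in> J) \<Longrightarrow> \<Phi> (\<Sum>i\<in>I. f i) t = (\<Sum>i\<in>I. \<Phi> (f i) t)"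
proof (induction I rule: infinite_finite_induct)
  case (insert i I)
  then have "(\<Sum>i\<in>I. f i) \<in> J" by (intro subspace_sum[OF subspace_J]) auto
  with insert show ?case by (simp add: rep_add)
qed (auto simp: rep_0)

end

lemma vl_disjoint_iff_rep:
  assumes "x \<in> J" "y \<in> J"
  shows "vl_disjoint x y \<longleftrightarrow> (\<forall>t\<in>topspace K. \<Phi> x t = 0 \<or> \<Phi> y t = 0)"
proof -
  have m: "inf \<bar>x\<bar> \<bar>y\<bar> \<in> J"
    by (rule solid_J[OF assms(1)]) (simp add: abs_of_nonneg)
  have "vl_disjoint x y \<longleftrightarrow> (\<forall>t\<in>topspace K. \<Phi> (inf \<bar>x\<bar> \<bar>y\<bar>) t = 0)"
    using rep_ext[OF m subspace_0[OF subspace_J]] by (auto simp: rep_0 vl_disjoint_def)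
  also have "\<dots> \<longleftrightarrow> (\<forall>t\<in>topspace K. min \<bar>\<Phi> x t\<bar> \<bar>\<Phi> y t\<bar> = 0)"
    using assms by (simp add: rep_inf rep_abs abs_J)
  also have "\<dots> \<longleftrightarrow> (\<forall>t\<in>topspace K. \<Phi> x t = 0 \<or> \<Phi> y t = 0)"
    by (auto simp: min_def split: if_splits)
  finally show ?thesis .
qed

text \<open>If \<open>x\<close> takes finitely many values on the support of \<open>w\<close>, fix one of them, \<open>r\<close>, and let \<open>\<delta>\<close> be a
  positive lower bound for the distance from \<open>r\<close> to the others. The element
  \<open>v = inf w (\<delta> \<bar>u\<bar> - \<bar>x - r \<bar>u\<bar>\<bar>)\<^sup>+\<close> is supported where \<open>w\<close> does not vanish and \<open>x\<close> is closer to \<open>r\<close>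
  than \<open>\<delta>\<close>, hence where \<open>x\<close> equals \<open>r\<close>. The formula uses the lattice operations alone, so \<open>v\<close> is
  an element of the vector lattice and not merely a continuous function.\<close>

lemma locally_scalar_if_finite_range:
  assumes x: "x \<in> J" and w: "w \<in> J" "0 \<le> w" "w \<noteq> 0"
    and fin: "finite R" and range: "\<And>t. t \<in> topspace K \<Longrightarrow> \<Phi> w t \<noteq> 0 \<Longrightarrow> \<Phi> x t \<in> R"
  obtains v r where "0 \<le> v" "v \<noteq> 0" "v \<le> w" "vl_disjoint (x - r *\<^sub>R \<bar>u\<bar>) v"
proof -
  have zero: "0 \<in> J" by (rule subspace_0[OF subspace_J])
  obtain t where t: "t \<in> topspace K" "\<Phi> w t \<noteq> 0"
    using rep_ext[OF w(1) zero] w(3) rep_0 by fastforce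
  define r where "r = \<Phi> x t"
  obtain \<delta> where \<delta>: "\<delta> > 0" "\<And>s. s \<in> R \<Longrightarrow> s \<noteq> r \<Longrightarrow> \<delta> \<le> dist r s"
    using finite_set_avoid[OF fin, of r] by blast
  define y where "y = \<delta> *\<^sub>R \<bar>u\<bar> - \<bar>x - r *\<^sub>R \<bar>u\<bar>\<bar>"
  define v where "v = inf w (pprt y)"
  have du: "\<delta> *\<^sub>R \<bar>u\<bar> \<in> J" "r *\<^sub>R \<bar>u\<bar> \<in> J" using unit_J subspace_scale[OF subspace_J] by auto
  have xr: "x - r *\<^sub>R \<bar>u\<bar> \<in> J" using x by (rule diff_scaled_unit_J)
  have yJ: "y \<in> J" unfolding y_def
    by (intro subspace_diff[OF subspace_J] du abs_J xr)
  have pJ: "pprt y \<in> J" by (rule solid_J[OF yJ abs_pprt_le])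
  have v0: "0 \<le> v" "v \<le> w" using w by (auto simp: v_def)
  then have vJ: "v \<in> J" by (intro solid_J[OF w(1)]) (simp add: abs_of_nonneg w(2))
  have rep_v: "\<Phi> v s = min (\<Phi> w s) (max (\<delta> - \<bar>\<Phi> x s - r\<bar>) 0)" if s: "s \<in> topspace K" for s
  proof -
    have "\<Phi> y s = \<delta> - \<bar>\<Phi> x s - r\<bar>"
      using s x by (simp add: y_def rep_diff du abs_J xr rep_abs rep_scaleR unit_J unit)
    moreover have "\<Phi> (pprt y) s = max (\<Phi> y s) 0"
      using rep_sup[OF s yJ zero] by (simp add: pprt_def rep_0[OF s])
    ultimately show ?thesis using s by (simp add: v_def rep_inf w pJ)
  qed
  have "\<Phi> w t = \<bar>\<Phi> w t\<bar>" using rep_abs[OF t(1) w(1)] w(2) by (simp add: abs_of_nonneg)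
  then have "\<Phi> w t > 0" using t(2) by linarith
  then have "\<Phi> v t > 0" using rep_v[OF t(1)] \<delta>(1) by (simp add: r_def)
  then have "v \<noteq> 0" using rep_0[OF t(1)] by auto
  moreover have "vl_disjoint (x - r *\<^sub>R \<bar>u\<bar>) v"
    unfolding vl_disjoint_iff_rep[OF xr vJ]
  proof
    fix s assume s: "s \<in> topspace K"
    have "\<Phi> x s = r" if "\<Phi> v s \<noteq> 0"
    proof (rule ccontr)
      assume ne: "\<Phi> x s \<noteq> r"
      have "\<Phi> w s = \<bar>\<Phi> w s\<bar>" using rep_abs[OF s w(1)] w(2) by (simp add: abs_of_nonneg)
      with rep_v[OF s] that have "\<Phi> w s \<noteq> 0" "\<bar>\<Phi> x s - r\<bar> < \<delta>"
        by (auto simp: min_def max_def split: if_splits)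
      with \<delta>(2)[OF range[OF s] ne] show False by (simp add: dist_real_def abs_minus_commute)
    qed
    then show "\<Phi> (x - r *\<^sub>R \<bar>u\<bar>) s = 0 \<or> \<Phi> v s = 0"
      using s x by (auto simp: rep_diff du rep_scaleR unit_J unit)
  qed
  ultimately show thesis using that v0 by blast
qed

lemma powers_in_subalgebra:
  assumes alg: "subalgebra_C K (\<Phi> ` J)" and x: "x \<in> J"
  obtains a where "\<And>k::nat. a k \<in> J" "\<And>k t. t \<in> topspace K \<Longrightarrow> \<Phi> (a k) t = \<Phi> x t ^ k"
proof -
  have "\<exists>a\<in>J. \<forall>t\<in>topspace K. \<Phi> a t = \<Phi> x t ^ k" for k :: nat
  proof (induction k)
    case 0
    then show ?case using unit_J unit by auto
  next
    case (Suc k)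
    then obtain a where a: "a \<in> J" "\<And>t. t \<in> topspace K \<Longrightarrow> \<Phi> a t = \<Phi> x t ^ k" by auto
    have "(\<lambda>t\<in>topspace K. \<Phi> x t * \<Phi> a t) \<in> \<Phi> ` J"
      using alg x a(1) by (auto simp: subalgebra_C_def)
    then obtain b where "b \<in> J" "\<Phi> b = (\<lambda>t\<in>topspace K. \<Phi> x t * \<Phi> a t)" by force
    then show ?case using a by (intro bexI[of _ b]) auto
  qed
  then obtain a where "\<forall>k::nat. a k \<in> J \<and> (\<forall>t\<in>topspace K. \<Phi> (a k) t = \<Phi> x t ^ k)" by metis
  with that show thesis by blast
qed

end

section \<open>Finite locally spanning families\<close>

text \<open>The spanning property of a d-basis, with the full system of bands replaced by a density condition.
  In this form finitely many elements can be treated one after the other by passing to smaller and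
  smaller \<open>w\<close>, with no common refinement of systems of bands. The sum may run over all of \<open>\<Gamma>\<close>
  because zero coefficients are admitted; it is meant for finite \<open>\<Gamma>\<close>.\<close>

definition locally_spanning :: "'i set \<Rightarrow> ('i \<Rightarrow> 'a::archimedean_vector_lattice) \<Rightarrow> bool"
  where "locally_spanning \<Gamma> e \<longleftrightarrow>
    (\<forall>x z. 0 \<le> z \<longrightarrow> z \<noteq> 0 \<longrightarrow>
       (\<exists>w c. 0 \<le> w \<and> w \<noteq> 0 \<and> w \<le> z \<and> vl_disjoint (x - (\<Sum>\<gamma>\<in>\<Gamma>. c \<gamma> *\<^sub>R e \<gamma>)) w))"

lemma vl_disjoint_below: "vl_disjoint x w \<Longrightarrow> 0 \<le> v \<Longrightarrow> v \<le> w \<Longrightarrow> vl_disjoint x v"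
  by (erule vl_disjoint_mono) (auto simp: abs_of_nonneg intro: order_trans)

text \<open>Disjointness from \<open>w\<close> is inherited by smaller elements, so the finitely many conditions can be met
  successively, each below the element found for the previous ones.\<close>

lemma dense_finite_intersection:
  fixes z :: "'a::archimedean_vector_lattice"
  assumes "finite A" "0 \<le> z" "z \<noteq> 0"
    and dense: "\<And>k z. k \<in> A \<Longrightarrow> 0 \<le> z \<Longrightarrow> z \<noteq> 0 \<Longrightarrow> \<exists>w c. 0 \<le> w \<and> w \<noteq> 0 \<and> w \<le> z \<and> vl_disjoint (f k c) w"
  shows "\<exists>w c. 0 \<le> w \<and> w \<noteq> 0 \<and> w \<le> z \<and> (\<forall>k\<in>A. vl_disjoint (f k (c k)) w)"
  using assms(1) dense
proof (induction A rule: finite_induct)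
  case empty
  then show ?case using assms by auto
next
  case (insert i A)
  then obtain w c where w: "0 \<le> w" "w \<noteq> 0" "w \<le> z" "\<And>k. k \<in> A \<Longrightarrow> vl_disjoint (f k (c k)) w"
    by (metis insertCI)
  obtain v d where v: "0 \<le> v" "v \<noteq> 0" "v \<le> w" "vl_disjoint (f i d) v"
    using insert.prems[of i w] w by blast
  have "\<forall>k\<in>insert i A. vl_disjoint (f k ((c(i := d)) k)) v"
    using v w vl_disjoint_below insert.hyps by fastforce
  with v order_trans[OF v(3) w(3)] show ?case by blast
qed

lemma d_basis_locally_spanning:
  fixes e :: "'i \<Rightarrow> 'a::archimedean_vector_lattice"
  assumes "d_basis \<Gamma> e" "finite \<Gamma>"
  shows "locally_spanning \<Gamma> e"
  unfolding locally_spanning_def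
proof (intro allI impI)
  fix x z :: 'a assume z: "0 \<le> z" "z \<noteq> 0"
  obtain \<X> where full: "full_disjoint_bands \<X>"
    and \<X>: "\<And>B. B \<in> \<X> \<Longrightarrow> \<exists>F c. F \<subseteq> \<Gamma> \<and> vl_disjoint_set (x - (\<Sum>\<gamma>\<in>F. c \<gamma> *\<^sub>R e \<gamma>)) B"
    using assms(1) unfolding d_basis_def by meson
  obtain B w where B: "B \<in> \<X>" and w: "w \<in> B" "0 \<le> w" "w \<noteq> 0" "w \<le> z"
    by (rule full_disjoint_bands_dense[OF full z])
  obtain F c where F: "F \<subseteq> \<Gamma>" and "vl_disjoint_set (x - (\<Sum>\<gamma>\<in>F. c \<gamma> *\<^sub>R e \<gamma>)) B"
    using \<X>[OF B] by blast
  then have "vl_disjoint (x - (\<Sum>\<gamma>\<in>F. c \<gamma> *\<^sub>R e \<gamma>)) w" using w by (simp add: vl_disjoint_set_def)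
  moreover have "(\<Sum>\<gamma>\<in>F. c \<gamma> *\<^sub>R e \<gamma>) = (\<Sum>\<gamma>\<in>\<Gamma>. (if \<gamma> \<in> F then c \<gamma> else 0) *\<^sub>R e \<gamma>)"
    by (rule sum.mono_neutral_cong_left[OF assms(2) F]) auto
  ultimately show "\<exists>w c. 0 \<le> w \<and> w \<noteq> 0 \<and> w \<le> z \<and>
      vl_disjoint (x - (\<Sum>\<gamma>\<in>\<Gamma>. c \<gamma> *\<^sub>R e \<gamma>)) w"
    using w by (intro exI[of _ w] exI[of _ "\<lambda>\<gamma>. if \<gamma> \<in> F then c \<gamma> else 0"]) simp
qed

text \<open>Disjointness of \<open>x - r u\<close> from \<open>w\<close> extends to the band generated by \<open>w\<close>, since that band is the
  second disjoint complement of \<open>w\<close>.\<close>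

lemma locally_spanning_singleton_d_basis:
  fixes u :: "'a::archimedean_vector_lattice"
  assumes span: "locally_spanning {()} (\<lambda>_. u)"
  shows "d_basis {()} (\<lambda>_. u)"
proof -
  have "d_independent {()} (\<lambda>_. u)"
    unfolding d_independent_def
  proof (intro allI impI ballI)
    fix B :: "'a set" and F :: "unit set" and c :: "unit \<Rightarrow> real" and \<gamma>
    assume "F \<subseteq> {()}" "\<forall>\<gamma>\<in>F. c \<gamma> \<noteq> 0" "\<gamma> \<in> F"
      and disj: "vl_disjoint_set (\<Sum>\<gamma>\<in>F. c \<gamma> *\<^sub>R u) B"
    then have F: "F = {()}" and c: "c () \<noteq> 0" by auto
    have "vl_disjoint u b" if "b \<in> B" for b
      using disj that vl_disjoint_scaleR[of "c () *\<^sub>R u" b "inverse (c ())"]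
      by (simp add: F c vl_disjoint_set_def)
    then show "vl_disjoint_set u B" by (simp add: vl_disjoint_set_def)
  qed
  moreover have "\<exists>\<X>. full_disjoint_bands \<X> \<and>
       (\<forall>B\<in>\<X>. \<exists>F c. finite F \<and> F \<subseteq> {()} \<and> (\<forall>\<gamma>\<in>F. c \<gamma> \<noteq> (0::real)) \<and>
          vl_disjoint_set (x - (\<Sum>\<gamma>\<in>F. c \<gamma> *\<^sub>R u)) B)" for x
  proof -
    have dense: "\<exists>w. 0 \<le> w \<and> w \<noteq> 0 \<and> w \<le> z \<and> (\<exists>r. vl_disjoint (x - r *\<^sub>R u) w)"
      if z: "0 \<le> z" "z \<noteq> 0" for z
    proof -
      obtain w c where "0 \<le> w" "w \<noteq> 0" "w \<le> z"
        "vl_disjoint (x - (\<Sum>\<gamma>\<in>{()}. c \<gamma> *\<^sub>R u)) w"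
        using span z unfolding locally_spanning_def by metis
      then show ?thesis by auto
    qed
    obtain \<X> where full: "full_disjoint_bands \<X>"
      and \<X>: "\<And>B. B \<in> \<X> \<Longrightarrow> \<exists>w. (\<exists>r. vl_disjoint (x - r *\<^sub>R u) w)
        \<and> B = disjoint_complement (disjoint_complement {w})"
      by (rule full_disjoint_bands_of_dense[OF dense]) (blast, blast, rule that, blast+)
    have "\<exists>F c. finite F \<and> F \<subseteq> {()} \<and> (\<forall>\<gamma>\<in>F. c \<gamma> \<noteq> (0::real)) \<and>
          vl_disjoint_set (x - (\<Sum>\<gamma>\<in>F. c \<gamma> *\<^sub>R u)) B" if B_in: "B \<in> \<X>" for B
    proof -
      obtain w r where w: "vl_disjoint (x - r *\<^sub>R u) w"
        and B: "B = disjoint_complement (disjoint_complement {w})"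
        using \<X>[OF B_in] by blast
      have disj: "vl_disjoint_set (x - r *\<^sub>R u) B"
        unfolding vl_disjoint_set_def
      proof
        fix b assume "b \<in> B"
        moreover have "x - r *\<^sub>R u \<in> disjoint_complement {w}"
          using w by (simp add: disjoint_complement_def vl_disjoint_set_def)
        ultimately have "vl_disjoint b (x - r *\<^sub>R u)"
          unfolding B disjoint_complement_def[of "disjoint_complement {w}"] vl_disjoint_set_def by blast
        then show "vl_disjoint (x - r *\<^sub>R u) b" by (rule vl_disjoint_commute[THEN iffD1])
      qed
      \<comment> \<open>A d-basis expansion has nonzero coefficients, so \<open>r = 0\<close> is the empty sum.\<close>
      show ?thesis
      proof (cases "r = 0")
        case True
        with disj show ?thesis by (intro exI[of _ "{}"]) simp
      next
        case False
        with disj show ?thesis by (intro exI[of _ "{()}"] exI[of _ "\<lambda>_. r"]) simp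
      qed
    qed
    with full show ?thesis by blast
  qed
  ultimately show ?thesis unfolding d_basis_def by blast
qed

text \<open>The only place where multiplication enters. Finitely many \<open>e \<gamma>\<close> span the \<open>card \<Gamma> + 1\<close> powers
  \<open>x\<^sup>0, \<dots>, x\<^bsup>card \<Gamma>\<^esup>\<close> locally, and the resulting linear relation between the powers makes the
  values of \<open>x\<close> roots of one nonzero polynomial.\<close>

lemma locally_scalar_in_local_algebra:
  fixes e :: "'i \<Rightarrow> 'a::archimedean_vector_lattice" and x u z :: 'a
  assumes alg: "local_algebra TYPE('a)" and fin: "finite \<Gamma>" and span: "locally_spanning \<Gamma> e"
    and x: "x \<in> principal_ideal u" and u: "0 \<le> u" and z: "0 \<le> z" "z \<noteq> 0"
  shows "\<exists>w r. 0 \<le> w \<and> w \<noteq> 0 \<and> w \<le> z \<and> vl_disjoint (x - r *\<^sub>R u) w"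
proof (cases "vl_disjoint u z")
  case True
  \<comment> \<open>The whole principal ideal of \<open>u\<close> is then disjoint from \<open>z\<close>, and the scalar 0 will do.\<close>
  obtain l where "\<bar>x\<bar> \<le> l *\<^sub>R \<bar>u\<bar>" using x by (auto simp: principal_ideal_def)
  then have "\<bar>x\<bar> \<le> \<bar>l *\<^sub>R u\<bar>" using u by (simp add: abs_of_nonneg order_trans[OF _ abs_ge_self])
  with vl_disjoint_scaleR[OF True] have "vl_disjoint x z"
    by (rule vl_disjoint_mono) simp
  then show ?thesis using z by (intro exI[of _ z] exI[of _ 0]) simp
next
  case False
  obtain K :: "('a \<Rightarrow> real) topology" and \<Phi> where rep: "kakutani_krein_rep u K \<Phi>"
    and sub: "subalgebra_C K (\<Phi> ` principal_ideal u)"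
    using alg unfolding local_algebra_def by blast
  interpret function_representation u K \<Phi>
    using rep by unfold_locales (auto simp: kakutani_krein_rep_def)
  have uu: "\<bar>u\<bar> = u" using u by (simp add: abs_of_nonneg)
  obtain a where a: "\<And>k::nat. a k \<in> J" "\<And>k t. t \<in> topspace K \<Longrightarrow> \<Phi> (a k) t = \<Phi> x t ^ k"
    by (rule powers_in_subalgebra[OF sub x]) blast
  let ?n = "card \<Gamma>"
  \<comment> \<open>Working below \<open>inf u z\<close> keeps \<open>w\<close> inside the principal ideal, where it has a representing
    function.\<close>
  have iz: "0 \<le> inf u z" "inf u z \<noteq> 0"
    using False u z by (auto simp: vl_disjoint_def abs_of_nonneg)
  have "\<exists>w c. 0 \<le> w \<and> w \<noteq> 0 \<and> w \<le> inf u z \<and>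
      (\<forall>k\<in>{..?n}. vl_disjoint (a k - (\<Sum>\<gamma>\<in>\<Gamma>. c k \<gamma> *\<^sub>R e \<gamma>)) w)"
    by (rule dense_finite_intersection[OF _ iz, where f = "\<lambda>k c. a k - (\<Sum>\<gamma>\<in>\<Gamma>. c \<gamma> *\<^sub>R e \<gamma>)"])
      (use span in \<open>auto simp: locally_spanning_def\<close>)
  then obtain w c where w: "0 \<le> w" "w \<noteq> 0" "w \<le> inf u z"
    and disj: "\<And>k. k \<le> ?n \<Longrightarrow> vl_disjoint (a k - (\<Sum>\<gamma>\<in>\<Gamma>. c k \<gamma> *\<^sub>R e \<gamma>)) w"
    by (metis atMost_iff)
  obtain l where l: "\<exists>k\<in>{..?n}. l k \<noteq> 0" "\<And>\<gamma>. \<gamma> \<in> \<Gamma> \<Longrightarrow> (\<Sum>k\<le>?n. l k * c k \<gamma>) = 0"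
    using exists_linear_dependence[OF fin, of "{..?n}" c] by auto
  define p where "p = (\<Sum>k\<le>?n. l k *\<^sub>R a k)"
  have "(\<Sum>k\<le>?n. l k *\<^sub>R (\<Sum>\<gamma>\<in>\<Gamma>. c k \<gamma> *\<^sub>R e \<gamma>)) = (\<Sum>\<gamma>\<in>\<Gamma>. (\<Sum>k\<le>?n. l k * c k \<gamma>) *\<^sub>R e \<gamma>)"
    unfolding scaleR_sum_right scaleR_sum_left scaleR_scaleR by (rule sum.swap)
  also have "\<dots> = 0" using l(2) by simp
  finally have "p = (\<Sum>k\<le>?n. l k *\<^sub>R (a k - (\<Sum>\<gamma>\<in>\<Gamma>. c k \<gamma> *\<^sub>R e \<gamma>)))"
    by (simp add: p_def scaleR_diff_right sum_subtractf)
  then have pw: "vl_disjoint p w"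
    using disj by (auto intro!: vl_disjoint_sum vl_disjoint_scaleR)
  have wJ: "w \<in> J"
    by (rule solid_J[OF unit_J]) (use w u in \<open>simp add: abs_of_nonneg\<close>)
  have pJ: "p \<in> J"
    unfolding p_def by (intro subspace_sum[OF subspace_J] subspace_scale[OF subspace_J] a)
  have rep_p: "\<Phi> p t = (\<Sum>k\<le>?n. l k * \<Phi> x t ^ k)" if "t \<in> topspace K" for t
    using that by (simp add: p_def rep_sum rep_scaleR subspace_scale[OF subspace_J] a)
  let ?R = "{s. (\<Sum>k\<le>?n. l k * s ^ k) = 0}"
  have "finite ?R" using l(1) by (subst polyfun_finite_roots) auto
  moreover have "\<Phi> x t \<in> ?R" if "t \<in> topspace K" "\<Phi> w t \<noteq> 0" for t
    using pw that rep_p unfolding vl_disjoint_iff_rep[OF pJ wJ] by auto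
  ultimately obtain v r where "0 \<le> v" "v \<noteq> 0" "v \<le> w" "vl_disjoint (x - r *\<^sub>R \<bar>u\<bar>) v"
    using locally_scalar_if_finite_range[OF x wJ w(1,2)] by blast
  moreover have "w \<le> z" using w(3) by (rule order_trans) simp
  ultimately show ?thesis unfolding uu by (blast intro: order_trans)
qed

theorem theorem4p13:
  fixes \<Gamma> :: "'i set" and e :: "'i \<Rightarrow> 'a::archimedean_vector_lattice"
  assumes local_alg: "local_algebra TYPE('a)"
    and no_singleton: "\<not> (\<exists>u::'a. d_basis {()} (\<lambda>_. u))"
    and basis: "d_basis \<Gamma> e"
  shows "infinite \<Gamma>"
proof
  assume fin: "finite \<Gamma>"
  have span: "locally_spanning \<Gamma> e" by (rule d_basis_locally_spanning[OF basis fin])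
  define u where "u = (\<Sum>\<gamma>\<in>\<Gamma>. \<bar>e \<gamma>\<bar>)"
  have u: "0 \<le> u" by (simp add: u_def sum_nonneg)
  have e: "e \<gamma> \<in> principal_ideal u" if "\<gamma> \<in> \<Gamma>" for \<gamma>
  proof -
    have "\<bar>e \<gamma>\<bar> \<le> u" unfolding u_def using sum_mono2[OF fin, of "{\<gamma>}" "\<lambda>\<gamma>. \<bar>e \<gamma>\<bar>"] that by simp
    then show ?thesis using u by (auto simp: principal_ideal_def abs_of_nonneg intro!: exI[of _ 1])
  qed
  have "locally_spanning {()} (\<lambda>_. u)"
    unfolding locally_spanning_def
  proof (intro allI impI)
    fix x z :: 'a assume z: "0 \<le> z" "z \<noteq> 0"
    obtain v c where v: "0 \<le> v" "v \<noteq> 0" "v \<le> z"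
      and x: "vl_disjoint (x - (\<Sum>\<gamma>\<in>\<Gamma>. c \<gamma> *\<^sub>R e \<gamma>)) v"
      using span z unfolding locally_spanning_def by blast
    have "\<exists>w r. 0 \<le> w \<and> w \<noteq> 0 \<and> w \<le> v \<and> (\<forall>\<gamma>\<in>\<Gamma>. vl_disjoint (e \<gamma> - r \<gamma> *\<^sub>R u) w)"
      using locally_scalar_in_local_algebra[OF local_alg fin span e u]
      by (intro dense_finite_intersection[OF fin v(1,2)]) blast
    then obtain w r where w: "0 \<le> w" "w \<noteq> 0" "w \<le> v"
      and er: "\<And>\<gamma>. \<gamma> \<in> \<Gamma> \<Longrightarrow> vl_disjoint (e \<gamma> - r \<gamma> *\<^sub>R u) w" by blast
    define s where "s = (\<Sum>\<gamma>\<in>\<Gamma>. c \<gamma> * r \<gamma>)"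
    have eq: "x - s *\<^sub>R u = (x - (\<Sum>\<gamma>\<in>\<Gamma>. c \<gamma> *\<^sub>R e \<gamma>)) + (\<Sum>\<gamma>\<in>\<Gamma>. c \<gamma> *\<^sub>R (e \<gamma> - r \<gamma> *\<^sub>R u))"
      by (simp add: s_def scaleR_diff_right sum_subtractf scaleR_sum_left)
    have "vl_disjoint (x - s *\<^sub>R u) w"
      unfolding eq
      by (intro vl_disjoint_add vl_disjoint_sum vl_disjoint_scaleR vl_disjoint_below[OF x w(1,3)] er)
    with v w show "\<exists>w c. 0 \<le> w \<and> w \<noteq> 0 \<and> w \<le> z \<and>
        vl_disjoint (x - (\<Sum>\<gamma>\<in>{()}. c \<gamma> *\<^sub>R u)) w"
      by (intro exI[of _ w] exI[of _ "\<lambda>_. s"]) (auto intro: order_trans)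
  qed
  then show False using locally_spanning_singleton_d_basis no_singleton by blast
qed

end
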